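(* Let $H$ be a Hilbert space and let $X\subset B(H)$ be an operator system (not necessarily unital). Let $A\subset B(H\oplus_2 H)$ be the unital operator system of all block matrices $\begin{pmatrix} \lambda \mathbf{1}_H & x \\ y & \lambda \mathbf{1}_H \end{pmatrix}$ with $\lambda\in\mathbb{C}$ and $x,y\in X$, and define $S:A\to A$ by $$S\begin{pmatrix} \lambda \mathbf{1}_H & x \\ y & \lambda \mathbf{1}_H \end{pmatrix}=2\lambda\,\mathbf{1}_{H\oplus_2 H}.$$ Then $S\geq_c I_A$, where $I_A$ is the identity map of $A$.
   Context: An operator system is a linear subspace of some $B(H)$ closed under taking adjoints; it is unital if it contains $\mathbf{1}$. For operator systems $A,B$ and a linear map $T:A\to B$, $T\ge0$ means $Ta\ge0$ for every $a\ge0$; $T\ge_c0$ (complete positivity) means $T\otimes I_{M_n}\ge0$ for every $n$; $T\ge_c S$ means $T-S\ge_c0$. *)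

theory Defs
  imports "HOL-Analysis.Analysis"
begin

section \<open>Complex Hilbert spaces\<close>

class scaleC =
  fixes scaleC :: "complex \<Rightarrow> 'a \<Rightarrow> 'a"  (infixr \<open>*\<^sub>C\<close> 75)

class complex_vector = real_vector + scaleC +
  assumes scaleC_add_right: "a *\<^sub>C (x + y) = a *\<^sub>C x + a *\<^sub>C y"
    and scaleC_add_left: "(a + b) *\<^sub>C x = a *\<^sub>C x + b *\<^sub>C x"
    and scaleC_scaleC: "a *\<^sub>C b *\<^sub>C x = (a * b) *\<^sub>C x"
    and scaleR_scaleC: "r *\<^sub>R x = complex_of_real r *\<^sub>C x"

interpretation complex_vector:
  vector_space "scaleC :: complex \<Rightarrow> 'a \<Rightarrow> 'a::complex_vector"
proof
  show "1 *\<^sub>C x = x" for x :: 'a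
    using scaleR_scaleC[of 1 x] by simp
qed (rule scaleC_add_right scaleC_add_left scaleC_scaleC)+

text \<open>The inner product is linear in its first and antilinear in its second argument.
  Positive definiteness follows from \<open>cinner_self\<close> and the norm axioms.\<close>

class complex_inner = real_normed_vector + complex_vector +
  fixes cinner :: "'a \<Rightarrow> 'a \<Rightarrow> complex"
  assumes cinner_commute: "cinner x y = cnj (cinner y x)"
    and cinner_add_left: "cinner (x + y) z = cinner x z + cinner y z"
    and cinner_scaleC_left: "cinner (a *\<^sub>C x) y = a * cinner x y"
    and cinner_self: "cinner x x = complex_of_real ((norm x)\<^sup>2)"

class chilbert_space = complex_inner + complete_space

lemma cinner_scaleC_right: "cinner x (a *\<^sub>C y) = cnj a * cinner x y"
  by (metis cinner_commute cinner_scaleC_left complex_cnj_mult)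

lemma norm_scaleC: "norm (a *\<^sub>C x) = cmod a * norm x" for x :: "'a::complex_inner"
proof -
  have "complex_of_real ((norm (a *\<^sub>C x))\<^sup>2) = (a * cnj a) * cinner x x"
    unfolding cinner_self[symmetric] by (simp add: cinner_scaleC_left cinner_scaleC_right)
  also have "\<dots> = complex_of_real ((cmod a * norm x)\<^sup>2)"
    by (simp only: cinner_self power_mult_distrib of_real_mult complex_norm_square)
  finally have "complex_of_real ((norm (a *\<^sub>C x))\<^sup>2) = complex_of_real ((cmod a * norm x)\<^sup>2)" .
  then have "(norm (a *\<^sub>C x))\<^sup>2 = (cmod a * norm x)\<^sup>2"
    by (simp only: of_real_eq_iff)
  then show ?thesis
    by simp
qed

instantiation complex :: chilbert_space
begin

definition scaleC_complex :: "complex \<Rightarrow> complex \<Rightarrow> complex"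
  where "scaleC_complex a x = a * x"

definition cinner_complex :: "complex \<Rightarrow> complex \<Rightarrow> complex"
  where "cinner_complex x y = x * cnj y"

instance
  by standard
    (simp_all add: scaleC_complex_def cinner_complex_def algebra_simps scaleR_conv_of_real
      complex_norm_square flip: of_real_power)

end

text \<open>The product type, with its library norm, is the Hilbert space direct sum \<open>H \<oplus>\<^sub>2 K\<close>.\<close>

instantiation prod :: (complex_vector, complex_vector) complex_vector
begin

definition scaleC_prod :: "complex \<Rightarrow> 'a \<times> 'b \<Rightarrow> 'a \<times> 'b"
  where "scaleC_prod a z = (a *\<^sub>C fst z, a *\<^sub>C snd z)"

instance
  by standard
    (simp_all add: scaleC_prod_def scaleC_add_right scaleC_add_left scaleC_scaleC
      scaleR_prod_def scaleR_scaleC)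

end

instantiation prod :: (complex_inner, complex_inner) complex_inner
begin

definition cinner_prod :: "'a \<times> 'b \<Rightarrow> 'a \<times> 'b \<Rightarrow> complex"
  where "cinner_prod z w = cinner (fst z) (fst w) + cinner (snd z) (snd w)"

instance
proof
  fix x y z :: "'a \<times> 'b" and a :: complex
  show "cinner x y = cnj (cinner y x)"
    unfolding cinner_prod_def by (simp flip: cinner_commute)
  show "cinner (x + y) z = cinner x z + cinner y z"
    by (simp add: cinner_prod_def cinner_add_left)
  show "cinner (a *\<^sub>C x) y = a * cinner x y"
    by (simp add: cinner_prod_def scaleC_prod_def cinner_scaleC_left distrib_left)
  show "cinner x x = complex_of_real ((norm x)\<^sup>2)"
    by (simp add: cinner_prod_def cinner_self norm_prod_def)
qed

end

instance prod :: (chilbert_space, chilbert_space) chilbert_space ..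


section \<open>Bounded operators\<close>

text \<open>The library type \<open>'a \<Rightarrow>\<^sub>L 'a\<close> consists of the bounded real-linear maps; \<open>B(H)\<close> is
  the subset of complex-linear ones.\<close>

definition bounded_ops :: "('a::complex_inner \<Rightarrow>\<^sub>L 'a) set"
  where "bounded_ops = {T. \<forall>c x. blinfun_apply T (c *\<^sub>C x) = c *\<^sub>C blinfun_apply T x}"

instantiation blinfun :: (real_normed_vector, complex_inner) complex_vector
begin

lift_definition scaleC_blinfun :: "complex \<Rightarrow> 'a \<Rightarrow>\<^sub>L 'b \<Rightarrow> 'a \<Rightarrow>\<^sub>L 'b"
  is "\<lambda>c f x. c *\<^sub>C f x"
proof -
  fix c :: complex and f :: "'a \<Rightarrow> 'b"
  assume "bounded_linear f"
  then interpret bounded_linear f .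
  obtain K where K: "\<And>x. norm (f x) \<le> norm x * K"
    using bounded by blast
  show "bounded_linear (\<lambda>x. c *\<^sub>C f x)"
  proof (rule bounded_linear_intro[where K = "cmod c * K"])
    show "norm (c *\<^sub>C f x) \<le> norm x * (cmod c * K)" for x
      using mult_left_mono[OF K[of x], of "cmod c"] by (simp add: norm_scaleC mult_ac)
  qed (simp_all add: add scaleR scaleC_add_right scaleR_scaleC scaleC_scaleC mult.commute)
qed

instance
  by standard
    (transfer; simp add: scaleC_add_right scaleC_add_left scaleC_scaleC scaleR_scaleC)+

end

definition is_cadjoint :: "('a::complex_inner \<Rightarrow>\<^sub>L 'a) \<Rightarrow> ('a \<Rightarrow>\<^sub>L 'a) \<Rightarrow> bool"
  where "is_cadjoint S T \<longleftrightarrow>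
    (\<forall>x y. cinner (blinfun_apply S x) y = cinner x (blinfun_apply T y))"

definition block_op ::
  "('a::real_normed_vector \<Rightarrow>\<^sub>L 'a) \<Rightarrow> ('a \<Rightarrow>\<^sub>L 'a) \<Rightarrow> ('a \<Rightarrow>\<^sub>L 'a) \<Rightarrow> ('a \<Rightarrow>\<^sub>L 'a)
    \<Rightarrow> (('a \<times> 'a) \<Rightarrow>\<^sub>L ('a \<times> 'a))"
  where "block_op a b c d = Blinfun (\<lambda>(u, v).
    (blinfun_apply a u + blinfun_apply b v, blinfun_apply c u + blinfun_apply d v))"

lemma block_op_apply:
  "blinfun_apply (block_op a b c d) (u, v) =
    (blinfun_apply a u + blinfun_apply b v, blinfun_apply c u + blinfun_apply d v)"
proof -
  have "bounded_linear (\<lambda>(u, v).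
    (blinfun_apply a u + blinfun_apply b v, blinfun_apply c u + blinfun_apply d v))"
    unfolding case_prod_beta
    by (intro bounded_linear_Pair bounded_linear_add
        bounded_linear_compose[OF blinfun.bounded_linear_right bounded_linear_fst]
        bounded_linear_compose[OF blinfun.bounded_linear_right bounded_linear_snd])
  then show ?thesis
    by (simp add: block_op_def bounded_linear_Blinfun_apply)
qed


section \<open>Operator systems and complete positivity\<close>

definition operator_system :: "('a::chilbert_space \<Rightarrow>\<^sub>L 'a) set \<Rightarrow> bool"
  where "operator_system X \<longleftrightarrow>
    X \<subseteq> bounded_ops \<and> complex_vector.subspace X \<and> (\<forall>T\<in>X. \<exists>S\<in>X. is_cadjoint S T)"

definition unital_operator_system :: "('a::chilbert_space \<Rightarrow>\<^sub>L 'a) set \<Rightarrow> bool"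
  where "unital_operator_system X \<longleftrightarrow> operator_system X \<and> id_blinfun \<in> X"

definition clinear_between ::
  "'a::complex_vector set \<Rightarrow> 'b::complex_vector set \<Rightarrow> ('a \<Rightarrow> 'b) \<Rightarrow> bool"
  where "clinear_between A B T \<longleftrightarrow>
    T ` A \<subseteq> B \<and> (\<forall>a\<in>A. \<forall>b\<in>A. T (a + b) = T a + T b) \<and> (\<forall>c. \<forall>a\<in>A. T (c *\<^sub>C a) = c *\<^sub>C T a)"

text \<open>\<open>M\<^sub>n(A) = A \<otimes> M\<^sub>n\<close> is represented by families \<open>M i j\<close> of which only the entries with
  \<open>i, j < n\<close> matter. Such a matrix acts on \<open>H\<^sup>n\<close> by
  \<open>(M \<xi>)\<^sub>i = (\<Sum>j<n. M i j \<xi>\<^sub>j)\<close>, and it is positive if \<open>\<langle>M \<xi>, \<xi>\<rangle> \<ge> 0\<close> for all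
  \<open>\<xi> \<in> H\<^sup>n\<close>.\<close>

definition op_matrices :: "nat \<Rightarrow> 'b set \<Rightarrow> (nat \<Rightarrow> nat \<Rightarrow> 'b) set"
  where "op_matrices n A = {M. \<forall>i<n. \<forall>j<n. M i j \<in> A}"

definition matrix_apply ::
  "nat \<Rightarrow> (nat \<Rightarrow> nat \<Rightarrow> 'a::complex_inner \<Rightarrow>\<^sub>L 'a) \<Rightarrow> (nat \<Rightarrow> 'a) \<Rightarrow> nat \<Rightarrow> 'a"
  where "matrix_apply n M \<xi> i = (\<Sum>j<n. blinfun_apply (M i j) (\<xi> j))"

definition cinner_power :: "nat \<Rightarrow> (nat \<Rightarrow> 'a::complex_inner) \<Rightarrow> (nat \<Rightarrow> 'a) \<Rightarrow> complex"
  where "cinner_power n \<xi> \<eta> = (\<Sum>i<n. cinner (\<xi> i) (\<eta> i))"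

definition positive_matrix :: "nat \<Rightarrow> (nat \<Rightarrow> nat \<Rightarrow> 'a::complex_inner \<Rightarrow>\<^sub>L 'a) \<Rightarrow> bool"
  where "positive_matrix n M \<longleftrightarrow> (\<forall>\<xi>. cinner_power n (matrix_apply n M \<xi>) \<xi> \<in> \<real>\<^sub>\<ge>\<^sub>0)"

text \<open>Positivity of \<open>T \<otimes> I\<close> on \<open>A \<otimes> M\<^sub>n\<close>, which applies \<open>T\<close> entrywise.\<close>

definition amplification_positive ::
  "nat \<Rightarrow> ('a::complex_inner \<Rightarrow>\<^sub>L 'a) set \<Rightarrow> (('a \<Rightarrow>\<^sub>L 'a) \<Rightarrow> ('b::complex_inner \<Rightarrow>\<^sub>L 'b)) \<Rightarrow> bool"
  where "amplification_positive n A T \<longleftrightarrow>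
    (\<forall>M\<in>op_matrices n A. positive_matrix n M \<longrightarrow> positive_matrix n (\<lambda>i j. T (M i j)))"

definition completely_positive ::
  "('a::complex_inner \<Rightarrow>\<^sub>L 'a) set \<Rightarrow> (('a \<Rightarrow>\<^sub>L 'a) \<Rightarrow> ('b::complex_inner \<Rightarrow>\<^sub>L 'b)) \<Rightarrow> bool"
  where "completely_positive A T \<longleftrightarrow> (\<forall>n. amplification_positive n A T)"

definition cp_ge ::
  "('a::complex_inner \<Rightarrow>\<^sub>L 'a) set \<Rightarrow> (('a \<Rightarrow>\<^sub>L 'a) \<Rightarrow> ('b::complex_inner \<Rightarrow>\<^sub>L 'b))
    \<Rightarrow> (('a \<Rightarrow>\<^sub>L 'a) \<Rightarrow> ('b \<Rightarrow>\<^sub>L 'b)) \<Rightarrow> bool"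
  where "cp_ge A T S \<longleftrightarrow> completely_positive A (\<lambda>a. T a - S a)"


section \<open>The block operator system\<close>

definition block_elem ::
  "complex \<Rightarrow> ('a::complex_inner \<Rightarrow>\<^sub>L 'a) \<Rightarrow> ('a \<Rightarrow>\<^sub>L 'a) \<Rightarrow> (('a \<times> 'a) \<Rightarrow>\<^sub>L ('a \<times> 'a))"
  where "block_elem c x y = block_op (c *\<^sub>C id_blinfun) x y (c *\<^sub>C id_blinfun)"

definition block_system ::
  "('a::complex_inner \<Rightarrow>\<^sub>L 'a) set \<Rightarrow> (('a \<times> 'a) \<Rightarrow>\<^sub>L ('a \<times> 'a)) set"
  where "block_system X = {block_elem c x y | c x y. x \<in> X \<and> y \<in> X}"

text \<open>The prescription \<open>block_elem c x y \<mapsto> 2c \<one>\<close> is consistent (also when \<open>H = 0\<close>, where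
  \<open>c\<close> is not determined by the operator).\<close>

lemma ex_block_scalar_map:
  fixes X :: "('a::complex_inner \<Rightarrow>\<^sub>L 'a) set"
  shows "\<exists>S :: (('a \<times> 'a) \<Rightarrow>\<^sub>L ('a \<times> 'a)) \<Rightarrow> (('a \<times> 'a) \<Rightarrow>\<^sub>L ('a \<times> 'a)).
    \<forall>c. \<forall>x\<in>X. \<forall>y\<in>X. S (block_elem c x y) = (2 * c) *\<^sub>C id_blinfun"
proof -
  have scalar: "(2 * c) *\<^sub>C (id_blinfun :: ('a \<times> 'a) \<Rightarrow>\<^sub>L ('a \<times> 'a)) = (2 * c') *\<^sub>C id_blinfun"
    if "block_elem c x y = block_elem c' x' y'" for c c' and x y x' y' :: "'a \<Rightarrow>\<^sub>L 'a"
  proof -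
    have "c *\<^sub>C v = c' *\<^sub>C v" for v :: 'a
    proof -
      have "fst (blinfun_apply (block_elem c x y) (v, 0)) =
          fst (blinfun_apply (block_elem c' x' y') (v, 0))"
        by (simp only: that)
      then show ?thesis
        by (simp add: block_elem_def block_op_apply scaleC_blinfun.rep_eq
            id_blinfun.rep_eq blinfun.zero_right)
    qed
    then have "(2 * c) *\<^sub>C v = (2 * c') *\<^sub>C v" for v :: 'a
      by (simp flip: scaleC_scaleC)
    then show ?thesis
      by (intro blinfun_eqI) (simp add: scaleC_blinfun.rep_eq scaleC_prod_def id_blinfun.rep_eq)
  qed
  let ?S = "\<lambda>a :: ('a \<times> 'a) \<Rightarrow>\<^sub>L ('a \<times> 'a).
    (2 * (SOME c. \<exists>x y. a = block_elem c x y)) *\<^sub>C (id_blinfun :: ('a \<times> 'a) \<Rightarrow>\<^sub>L ('a \<times> 'a))"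
  have "?S (block_elem c x y) = (2 * c) *\<^sub>C id_blinfun" for c x y
  proof -
    have "\<exists>c' x' y'. block_elem c x y = block_elem c' x' y'"
      by blast
    from someI_ex[OF this] obtain x' y' where
      "block_elem c x y = block_elem (SOME c'. \<exists>x' y'. block_elem c x y = block_elem c' x' y') x' y'"
      by blast
    from scalar[OF this] show ?thesis
      by (rule sym)
  qed
  then show ?thesis
    by (intro exI[of _ ?S]) blast
qed

end

theory Submission
  imports Defs
begin

text \<open>
  Conjugation by the symmetry \<open>U = diag(1, -1)\<close> of \<open>H \<oplus> H\<close> fixes the diagonal of a block
  matrix and changes the sign of the off-diagonal corners. Hence, for
  \<open>a = block_elem c x y\<close>, one has \<open>S a - a = block_elem c (-x) (-y) = U\<^sup>* a U\<close>, that is,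
  \<open>S - I\<close> is the restriction of a conjugation to the block operator system, and such a map is
  completely positive: \<open>\<langle>(U\<^sup>* M\<^sub>i\<^sub>j U) \<xi>, \<xi>\<rangle> = \<langle>(M\<^sub>i\<^sub>j) U\<xi>, U\<xi>\<rangle>\<close>, with \<open>U\<close> acting entrywise
  on \<open>\<xi>\<close>. The lemmas \<open>two_scalar_minus_block_elem\<close> and \<open>cinner_block_elem_flip\<close> carry this
  argument. That the block matrices form a unital operator system and that \<open>S\<close> is linear is
  entrywise arithmetic, the adjoint being
  \<open>(block_elem c x y)\<^sup>* = block_elem (cnj c) (y\<^sup>*) (x\<^sup>*)\<close>.
\<close>

lemma cinner_minus_left: "cinner (- x) y = - cinner x y"
  using cinner_scaleC_left[of "-1" x y] by simp

lemma cinner_diff_left: "cinner (x - y) z = cinner x z - cinner y z"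
  using cinner_add_left[of x "- y" z] by (simp add: cinner_minus_left)

lemma cinner_add_right: "cinner x (y + z) = cinner x y + cinner x z"
  by (metis cinner_add_left cinner_commute complex_cnj_add)

lemma cinner_minus_right: "cinner x (- y) = - cinner x y"
  using cinner_scaleC_right[of x "-1" y] by simp

lemma block_elem_apply:
  "blinfun_apply (block_elem c x y) w =
    (c *\<^sub>C fst w + blinfun_apply x (snd w), blinfun_apply y (fst w) + c *\<^sub>C snd w)"
  by (cases w) (simp add: block_elem_def block_op_apply scaleC_blinfun.rep_eq id_blinfun.rep_eq)

lemma block_elem_add:
  "block_elem c x y + block_elem c' x' y' = block_elem (c + c') (x + x') (y + y')"
  by (intro blinfun_eqI) (simp add: block_elem_apply blinfun.add_left scaleC_add_left)

lemma block_elem_scaleC: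
  "d *\<^sub>C block_elem c x y = block_elem (d * c) (d *\<^sub>C x) (d *\<^sub>C y)"
  by (intro blinfun_eqI)
    (simp add: block_elem_apply scaleC_blinfun.rep_eq scaleC_prod_def scaleC_add_right scaleC_scaleC)

lemma block_elem_scalar: "block_elem c 0 0 = c *\<^sub>C id_blinfun"
  by (intro blinfun_eqI)
    (simp add: block_elem_apply scaleC_blinfun.rep_eq scaleC_prod_def id_blinfun.rep_eq)

lemma two_scalar_minus_block_elem:
  "(2 * c) *\<^sub>C id_blinfun - block_elem c x y = block_elem c (- x) (- y)"
proof -
  have "(2 * c) *\<^sub>C id_blinfun = block_elem c (- x) (- y) + block_elem c x y"
    by (simp add: block_elem_add flip: block_elem_scalar)
  then show ?thesis
    by simp
qed

lemma block_elem_in_bounded_ops: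
  assumes "x \<in> bounded_ops" and "y \<in> bounded_ops"
  shows "block_elem c x y \<in> bounded_ops"
  using assms
  by (simp add: bounded_ops_def block_elem_apply scaleC_prod_def scaleC_add_right scaleC_scaleC
      mult.commute)

lemma is_cadjoint_block_elem:
  assumes "is_cadjoint x' x" and "is_cadjoint y' y"
  shows "is_cadjoint (block_elem (cnj c) y' x') (block_elem c x y)"
  using assms
  by (simp add: is_cadjoint_def block_elem_apply cinner_prod_def cinner_add_left cinner_add_right
      cinner_scaleC_left cinner_scaleC_right)

lemma unital_operator_system_block_system:
  fixes X :: "('h::chilbert_space \<Rightarrow>\<^sub>L 'h) set"
  assumes "operator_system X"
  shows "unital_operator_system (block_system X)"
proof -
  have bdd: "X \<subseteq> bounded_ops" and sub: "complex_vector.subspace X"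
    and adj: "\<And>T. T \<in> X \<Longrightarrow> \<exists>T'\<in>X. is_cadjoint T' T"
    using assms by (auto simp: operator_system_def)
  have zero: "0 \<in> X"
    using sub by (rule complex_vector.subspace_0)
  have scalar: "c *\<^sub>C id_blinfun \<in> block_system X" for c
    unfolding block_system_def using zero block_elem_scalar[of c, symmetric] by blast
  have "block_system X \<subseteq> bounded_ops"
    unfolding block_system_def using bdd by (auto intro!: block_elem_in_bounded_ops)
  moreover have "complex_vector.subspace (block_system X)"
  proof (rule complex_vector.subspaceI)
    show "0 \<in> block_system X"
      using scalar[of 0] by simp
  next
    fix a b assume "a \<in> block_system X" "b \<in> block_system X"
    then show "a + b \<in> block_system X"
      unfolding block_system_def
      using complex_vector.subspace_add[OF sub] by (fastforce simp: block_elem_add)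
  next
    fix d a assume "a \<in> block_system X"
    then show "d *\<^sub>C a \<in> block_system X"
      unfolding block_system_def
      using complex_vector.subspace_scale[OF sub] by (fastforce simp: block_elem_scaleC)
  qed
  moreover have "\<exists>b\<in>block_system X. is_cadjoint b a" if "a \<in> block_system X" for a
  proof -
    from that obtain c x y where a: "a = block_elem c x y" and "x \<in> X" "y \<in> X"
      by (auto simp: block_system_def)
    then obtain x' y' where "x' \<in> X" "is_cadjoint x' x" "y' \<in> X" "is_cadjoint y' y"
      using adj by blast
    then show ?thesis
      unfolding a block_system_def using is_cadjoint_block_elem by blast
  qed
  moreover have "id_blinfun \<in> block_system X"
    using scalar[of 1] by simp
  ultimately show ?thesis
    by (simp add: unital_operator_system_def operator_system_def)
qed

text \<open>The symmetry \<open>diag(1, -1)\<close> of \<open>H \<oplus> H\<close>, as a map on vectors.\<close>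

definition flip_snd :: "'a \<times> 'a \<Rightarrow> 'a \<times> 'a::real_normed_vector"
  where "flip_snd w = (fst w, - snd w)"

lemma cinner_block_elem_flip:
  "cinner (blinfun_apply (block_elem c (- x) (- y)) v) w =
    cinner (blinfun_apply (block_elem c x y) (flip_snd v)) (flip_snd w)"
  by (simp add: flip_snd_def block_elem_apply cinner_prod_def cinner_add_left cinner_diff_left
      cinner_minus_right blinfun.minus_left blinfun.minus_right)

lemma cinner_power_matrix_apply:
  "cinner_power n (matrix_apply n M \<xi>) \<xi> =
    (\<Sum>i<n. \<Sum>j<n. cinner (blinfun_apply (M i j) (\<xi> j)) (\<xi> i))"
proof -
  have "cinner (\<Sum>j<m. f j) w = (\<Sum>j<m. cinner (f j) w)" for f :: "nat \<Rightarrow> 'a" and w m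
  proof (induction m)
    case 0
    show ?case
      using cinner_scaleC_left[of 0 0 w] by simp
  qed (simp add: cinner_add_left)
  then show ?thesis
    by (simp add: cinner_power_def matrix_apply_def)
qed

theorem proposition3p2p1:
  fixes X :: "('h::chilbert_space \<Rightarrow>\<^sub>L 'h) set"
    and S :: "(('h \<times> 'h) \<Rightarrow>\<^sub>L ('h \<times> 'h)) \<Rightarrow> (('h \<times> 'h) \<Rightarrow>\<^sub>L ('h \<times> 'h))"
  assumes "operator_system X"
    and "\<And>c x y. x \<in> X \<Longrightarrow> y \<in> X \<Longrightarrow> S (block_elem c x y) = (2 * c) *\<^sub>C id_blinfun"
  shows "unital_operator_system (block_system X) \<and>
    clinear_between (block_system X) (block_system X) S \<and>
    cp_ge (block_system X) S (\<lambda>a. a)"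
proof (intro conjI)
  show unital: "unital_operator_system (block_system X)"
    using assms(1) by (rule unital_operator_system_block_system)
  have sub: "complex_vector.subspace X"
    using assms(1) by (simp add: operator_system_def)
  show "clinear_between (block_system X) (block_system X) S"
    unfolding clinear_between_def
  proof (intro conjI ballI allI image_subsetI)
    fix a assume "a \<in> block_system X"
    then obtain c x y where a: "a = block_elem c x y" "x \<in> X" "y \<in> X"
      by (auto simp: block_system_def)
    show "S a \<in> block_system X"
      using unital complex_vector.subspace_scale[of "block_system X" id_blinfun "2 * c"]
      by (simp add: a assms(2) unital_operator_system_def operator_system_def)
    show "S (d *\<^sub>C a) = d *\<^sub>C S a" for d
      using a complex_vector.subspace_scale[OF sub]
      by (simp add: block_elem_scaleC assms(2) scaleC_scaleC mult.left_commute)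
    fix b assume "b \<in> block_system X"
    then obtain c' x' y' where b: "b = block_elem c' x' y'" "x' \<in> X" "y' \<in> X"
      by (auto simp: block_system_def)
    show "S (a + b) = S a + S b"
      using a b complex_vector.subspace_add[OF sub]
      by (simp add: block_elem_add assms(2) distrib_left scaleC_add_left)
  qed
  show "cp_ge (block_system X) S (\<lambda>a. a)"
    unfolding cp_ge_def completely_positive_def amplification_positive_def
  proof (intro allI ballI impI)
    fix n and M :: "nat \<Rightarrow> nat \<Rightarrow> ('h \<times> 'h) \<Rightarrow>\<^sub>L ('h \<times> 'h)"
    assume M: "M \<in> op_matrices n (block_system X)" and pos: "positive_matrix n M"
    have conj: "cinner (blinfun_apply (S a - a) v) w
        = cinner (blinfun_apply a (flip_snd v)) (flip_snd w)"
      if "a \<in> block_system X" for a v w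
      using that
      by (auto simp: block_system_def assms(2) two_scalar_minus_block_elem cinner_block_elem_flip)
    have "cinner_power n (matrix_apply n (\<lambda>i j. S (M i j) - M i j) \<xi>) \<xi> =
        cinner_power n (matrix_apply n M (\<lambda>i. flip_snd (\<xi> i))) (\<lambda>i. flip_snd (\<xi> i))" for \<xi>
      using M by (simp add: cinner_power_matrix_apply op_matrices_def conj)
    then show "positive_matrix n (\<lambda>i j. S (M i j) - M i j)"
      using pos by (simp add: positive_matrix_def)
  qed
qed

end
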